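(* Let $(x,\xi)\in V^1$ and $(y,\eta)\in V^2$. Then $C_1(x,\xi)=C_2(y,\eta)$ if and only if there is a broken ray $\nu$ (in the family, near $\nu_0$) joining $x$ and $y$, with $x$ on its incoming part and $y$ on its reflected part, such that (a) $x$ and $y$ are conjugate points along $\nu$; (b) $\xi$ and $\eta$ satisfy $$\xi=\lambda\, w(\alpha_1),\qquad \eta=\frac{\lambda}{\det(d\chi)}\Big(\frac{d\alpha_2}{d\alpha_1}\Big) w(\alpha_2)\qquad\text{for some }\lambda\neq0,$$ where $\alpha_1$ is the angle of the incoming part and $\alpha_2$ is the angle of the reflected part of $\nu$, and $\det(d\chi)$ is evaluated at the incoming line $(s_1,\alpha_1)$ of $\nu$.
   Context: Work in $\mathbb{R}^2$ with $v(\alpha)=(\cos\alpha,\sin\alpha)$, $w(\alpha)=(-\sin\alpha,\cos\alpha)$. A pair $(s,\alpha)$ represents the directed line $\{x: x\cdot w(\alpha)=s\}$ with direction $v(\alpha)$. A smooth family of broken rays is given by a diffeomorphism $\chi:(s_1,\alpha_1)\mapsto(s_2,\alpha_2)$ between open sets of directed lines: a broken ray is the union of an incoming part $l_1$ on the line $(s_1,\alpha_1)$ and an outgoing (reflected) part $l_2$ on the line $(s_2,\alpha_2)=\chi(s_1,\alpha_1)$. We work away from the part connecting $l_1$ and $l_2$. Conjugate points. For $x$ on $l_1$, let the angle $\alpha_1$ vary with $x$ fixed, so $s_1=\langle x,w(\alpha_1)\rangle$ and $(s_2,\alpha_2)=\chi(s_1,\alpha_1)$ are functions of $\alpha_1$;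 write $$\frac{d\alpha_2}{d\alpha_1}=\frac{\partial\alpha_2}{\partial\alpha_1}-\langle x,v(\alpha_1)\rangle\frac{\partial\alpha_2}{\partial s_1}$$ for the derivative with $x$ fixed. With $q_0$ the starting point of $l_2$, chosen smoothly with $\langle q_0,w(\alpha_2)\rangle=s_2$ and reached at time $t_2$, set $l_2(t)=q_0+(t-t_2)v(\alpha_2)$. The point $y=l_2(t)$ on $l_2$ is conjugate to $x$ along the broken ray if the differential of $(t,\alpha_1)\mapsto l_2(t)$ is not an isomorphism there. Microlocal setting. Fix a broken ray $\nu_0$, points $x_1$, $x_2$ on its incoming and outgoing parts, and nonzero covectors $\xi^1,\xi^2$ at $x_1,x_2$ conormal to these parts. Let $\Gamma(\nu_0)$ be a small neighborhood of $\nu_0$ in the family of broken rays, $U_1,U_2$ disjoint small neighborhoods of $x_1,x_2$ with $U_1$ disjoint from all outgoing parts and $U_2$ disjoint from all incoming parts of rays in $\Gamma(\nu_0)$, and let $V^i$ be a small conic neighborhood of $(x_i,\xi^i)$ over $U_i$. Let $R$ be the (weighted) Radon transform $Rf(s,\alpha)=\int_{y\cdot w(\alpha)=s}a(y,\alpha)f(y)\,dy$, with smooth nonvanishing weight $a$. Its canonical relation is $$C_R:\ (y,\eta)\mapsto(s,\alpha,\widehat s,\widehat\alpha)=\big(\langle y,w(\alpha)\rangle,\ \alpha,\ \lambda,\ \lambda\langle v(\alpha),y\rangle\big),\qquad \eta=\lambda w(\alpha),\ \lambda\neq0 ,$$ where the sign of $\lambda$ (equivalently, the orientation of the line) is chosen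 so that $(s,\alpha)$ is close to the corresponding directed line of $\nu_0$ (the incoming line for $(y,\eta)\in V^1$, the outgoing line for $(y,\eta)\in V^2$). The pull-back $\chi^*g=g\circ\chi$ has canonical relation $$C_{\chi^*}:\ (s_2,\alpha_2,\widehat{s_2},\widehat{\alpha_2})\mapsto(s_1,\alpha_1,\widehat{s_1},\widehat{\alpha_1}),\qquad (s_2,\alpha_2)=\chi(s_1,\alpha_1),\quad (\widehat{s_1},\widehat{\alpha_1})=(\widehat{s_2},\widehat{\alpha_2})\,d\chi ,$$ with covectors written as row vectors and $d\chi=\frac{\partial(s_2,\alpha_2)}{\partial(s_1,\alpha_1)}$ evaluated at $(s_1,\alpha_1)$. Then $C_1$ is $C_R$ on $V^1$, and $C_2=C_{\chi^*}\circ C_R$ on $V^2$; these are the canonical relations of the broken ray transform near $\nu_0$ restricted to distributions with wave front set in $V^1$ and in $V^2$, respectively. *)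

theory Defs
  imports "HOL-Analysis.Analysis"
begin

section \<open>Smooth maps on open sets\<close>

primrec Ck_on :: "nat \<Rightarrow> ('a::euclidean_space \<Rightarrow> 'b::real_normed_vector) \<Rightarrow> 'a set \<Rightarrow> bool" where
  "Ck_on 0 f S \<longleftrightarrow> continuous_on S f"
| "Ck_on (Suc k) f S \<longleftrightarrow>
     (\<forall>x\<in>S. f differentiable (at x)) \<and> (\<forall>u. Ck_on k (\<lambda>x. frechet_derivative f (at x) u) S)"

text \<open>Only meaningful for open \<open>S\<close>, since derivatives are taken at \<open>at x\<close>.\<close>
definition smooth_on :: "('a::euclidean_space \<Rightarrow> 'b::real_normed_vector) \<Rightarrow> 'a set \<Rightarrow> bool" where
  "smooth_on f S \<longleftrightarrow> (\<forall>k. Ck_on k f S)"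

definition diffeomorphism_on ::
  "('a::euclidean_space \<Rightarrow> 'b::euclidean_space) \<Rightarrow> 'a set \<Rightarrow> 'b set \<Rightarrow> bool" where
  "diffeomorphism_on f S T \<longleftrightarrow> open S \<and> open T \<and> bij_betw f S T \<and>
     smooth_on f S \<and> smooth_on (inv_into S f) T"


section \<open>Directed lines and broken rays\<close>

definition vdir :: "real \<Rightarrow> real^2" where "vdir \<alpha> = vector [cos \<alpha>, sin \<alpha>]"
definition wdir :: "real \<Rightarrow> real^2" where "wdir \<alpha> = vector [- sin \<alpha>, cos \<alpha>]"

text \<open>A directed line is given by its coordinates \<open>\<nu> = vector [s, \<alpha>]\<close>, with \<open>\<alpha>\<close> a real angle
  (not reduced modulo \<open>2 * pi\<close>).  Open sets of such pairs cover every coordinate chart of the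
  cylinder of directed lines, and everything below is local near one ray.\<close>

definition line :: "real^2 \<Rightarrow> (real^2) set" where
  "line \<nu> = {x. x \<bullet> wdir (\<nu>$2) = \<nu>$1}"

text \<open>A broken ray is indexed by the coordinates \<open>\<nu>\<close> of its incoming line.  The incoming part
  ends at the point \<open>in_end \<nu>\<close> and has length \<open>in_len \<nu>\<close>; the outgoing part
  starts at \<open>out_start \<nu>\<close>, at time \<open>out_time \<nu>\<close>, and has length \<open>out_len \<nu>\<close>.
  Lengths may be infinite, so half-lines and segments are both allowed.  The points \<open>in_end \<nu>\<close> and
  \<open>out_start \<nu>\<close> need not coincide: nothing is assumed about the part connecting them.\<close>

record rays =
  dom_in :: "(real^2) set"
  dom_out :: "(real^2) set"
  chi :: "real^2 \<Rightarrow> real^2"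
  in_end :: "real^2 \<Rightarrow> real^2"
  in_len :: "real^2 \<Rightarrow> ereal"
  out_start :: "real^2 \<Rightarrow> real^2"
  out_time :: "real^2 \<Rightarrow> real"
  out_len :: "real^2 \<Rightarrow> ereal"

definition broken_ray_family :: "rays \<Rightarrow> bool" where
  "broken_ray_family B \<longleftrightarrow>
     diffeomorphism_on (chi B) (dom_in B) (dom_out B) \<and>
     smooth_on (in_end B) (dom_in B) \<and>
     smooth_on (out_start B) (dom_in B) \<and>
     smooth_on (out_time B) (dom_in B) \<and>
     continuous_on (dom_in B) (in_len B) \<and>
     continuous_on (dom_in B) (out_len B) \<and>
     (\<forall>\<nu>\<in>dom_in B. in_end B \<nu> \<in> line \<nu> \<and> out_start B \<nu> \<in> line (chi B \<nu>) \<and>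
        0 < in_len B \<nu> \<and> 0 < out_len B \<nu>)"

definition l2 :: "rays \<Rightarrow> real^2 \<Rightarrow> real \<Rightarrow> real^2" where
  "l2 B \<nu> t = out_start B \<nu> + (t - out_time B \<nu>) *\<^sub>R vdir (chi B \<nu> $ 2)"

text \<open>The end points are excluded, i.e. one stays away from the connecting part.\<close>

definition incoming :: "rays \<Rightarrow> real^2 \<Rightarrow> (real^2) set" where
  "incoming B \<nu> = {in_end B \<nu> - r *\<^sub>R vdir (\<nu>$2) | r. 0 < r \<and> ereal r < in_len B \<nu>}"

definition outgoing :: "rays \<Rightarrow> real^2 \<Rightarrow> (real^2) set" where
  "outgoing B \<nu> =
     {l2 B \<nu> t | t. out_time B \<nu> < t \<and> ereal (t - out_time B \<nu>) < out_len B \<nu>}"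


section \<open>Conjugate points\<close>

text \<open>Coordinates of the directed line with angle \<open>\<alpha>\<close> through \<open>x\<close>.\<close>
definition line_through :: "real^2 \<Rightarrow> real \<Rightarrow> real^2" where
  "line_through x \<alpha> = vector [x \<bullet> wdir \<alpha>, \<alpha>]"

definition d\<alpha>2_d\<alpha>1 :: "rays \<Rightarrow> real^2 \<Rightarrow> real \<Rightarrow> real" where
  "d\<alpha>2_d\<alpha>1 B x \<alpha> = deriv (\<lambda>a. chi B (line_through x a) $ 2) \<alpha>"

definition conjugate_along :: "rays \<Rightarrow> real^2 \<Rightarrow> real^2 \<Rightarrow> real^2 \<Rightarrow> bool" where
  "conjugate_along B \<nu> x y \<longleftrightarrow>
     (\<exists>t. y = l2 B \<nu> t \<and>
        \<not> bij (frechet_derivative (\<lambda>(t, a). l2 B (line_through x a) t) (at (t, \<nu>$2))))"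

definition d\<chi> :: "rays \<Rightarrow> real^2 \<Rightarrow> real^2^2" where
  "d\<chi> B \<nu> = jacobian (chi B) (at \<nu>)"

lemma line_through_eq: "x \<in> line \<nu> \<Longrightarrow> line_through x (\<nu>$2) = \<nu>"
  by (simp add: line_through_def line_def vec_eq_iff forall_2)

lemma line_through_has_derivative:
  "(line_through x has_derivative (\<lambda>h. h *\<^sub>R vector [- (x \<bullet> vdir \<alpha>), 1])) (at \<alpha>)"
proof (subst has_derivative_componentwise_within, intro ballI)
  fix i :: "real^2" assume "i \<in> Basis"
  then consider "i = axis 1 1" | "i = axis 2 1"
    by (auto simp: Basis_vec_def UNIV_2)
  then show "((\<lambda>a. line_through x a \<bullet> i) has_derivative
      (\<lambda>h. (h *\<^sub>R vector [- (x \<bullet> vdir \<alpha>), 1]) \<bullet> i)) (at \<alpha>)"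
    by cases (auto simp: inner_axis line_through_def wdir_def vdir_def inner_vec_def sum_2
        algebra_simps intro!: derivative_eq_intros)
qed

lemma d\<alpha>2_d\<alpha>1_eq:
  assumes "broken_ray_family B" "\<nu> \<in> dom_in B" "x \<in> line \<nu>"
  shows "d\<alpha>2_d\<alpha>1 B x (\<nu>$2) = d\<chi> B \<nu> $ 2 $ 2 - (x \<bullet> vdir (\<nu>$2)) * d\<chi> B \<nu> $ 2 $ 1"
proof -
  have "Ck_on (Suc 0) (chi B) (dom_in B)"
    using assms(1) unfolding broken_ray_family_def diffeomorphism_on_def smooth_on_def by blast
  then have "(chi B has_derivative (\<lambda>h. d\<chi> B \<nu> *v h)) (at (line_through x (\<nu>$2)))"
    using assms(2,3) by (simp add: d\<chi>_def jacobian_works line_through_eq)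
  from has_derivative_compose[OF line_through_has_derivative this]
  have "((\<lambda>a. chi B (line_through x a) $ 2) has_derivative
      (\<lambda>h. (d\<chi> B \<nu> *v (h *\<^sub>R vector [- (x \<bullet> vdir (\<nu>$2)), 1])) $ 2)) (at (\<nu>$2))"
    by (rule bounded_linear.has_derivative[OF bounded_linear_vec_nth])
  moreover have "(\<lambda>h. (d\<chi> B \<nu> *v (h *\<^sub>R vector [- (x \<bullet> vdir (\<nu>$2)), 1])) $ 2) =
      (*) (d\<chi> B \<nu> $ 2 $ 2 - (x \<bullet> vdir (\<nu>$2)) * d\<chi> B \<nu> $ 2 $ 1)"
    by (auto simp: matrix_vector_mult_def sum_2 algebra_simps)
  ultimately show ?thesis
    unfolding d\<alpha>2_d\<alpha>1_def by (intro DERIV_imp_deriv) (simp add: has_field_derivative_def)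
qed


section \<open>Canonical relations\<close>

text \<open>Covectors are identified with vectors of \<open>real^2\<close>, those on the space of lines being row
  vectors \<open>vector [s_hat, \<alpha>_hat]\<close>.  Of the two orientations of the line conormal to \<open>\<eta>\<close>, the one
  with angle less than \<open>pi/2\<close> away from the reference angle \<open>\<alpha>0\<close> is taken.\<close>

type_synonym phase = "(real^2) \<times> (real^2)"

definition C_R :: "real \<Rightarrow> (phase \<times> phase) set" where
  "C_R \<alpha>0 =
     {((y, \<mu> *\<^sub>R wdir \<alpha>), (vector [y \<bullet> wdir \<alpha>, \<alpha>], vector [\<mu>, \<mu> * (vdir \<alpha> \<bullet> y)])) | y \<mu> \<alpha>.
        \<mu> \<noteq> 0 \<and> \<bar>\<alpha> - \<alpha>0\<bar> < pi / 2}"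

definition C_pullback :: "rays \<Rightarrow> (phase \<times> phase) set" where
  "C_pullback B = {((chi B \<nu>, \<theta>), (\<nu>, \<theta> v* d\<chi> B \<nu>)) | \<nu> \<theta>. \<nu> \<in> dom_in B}"

definition C1 :: "real^2 \<Rightarrow> phase set \<Rightarrow> (phase \<times> phase) set" where
  "C1 \<nu>0 V = {(p, q) \<in> C_R (\<nu>0$2). p \<in> V}"

text \<open>Relational composition \<open>O\<close> applies its left argument first.\<close>
definition C2 :: "rays \<Rightarrow> real^2 \<Rightarrow> phase set \<Rightarrow> (phase \<times> phase) set" where
  "C2 B \<nu>0 V = {(p, q) \<in> C_R (chi B \<nu>0 $ 2) O C_pullback B. p \<in> V}"

definition same_value :: "('a \<times> 'c) set \<Rightarrow> 'a \<Rightarrow> ('b \<times> 'c) set \<Rightarrow> 'b \<Rightarrow> bool" where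
  "same_value C a C' b \<longleftrightarrow> (\<exists>p. C `` {a} = {p} \<and> C' `` {b} = {p})"

definition conic_nbhd :: "real^2 \<Rightarrow> real^2 \<Rightarrow> phase set \<Rightarrow> bool" where
  "conic_nbhd x \<xi> V \<longleftrightarrow> open V \<and> (x, \<xi>) \<in> V \<and>
     (\<forall>(y, \<eta>)\<in>V. \<eta> \<noteq> 0 \<and> (\<forall>r>0. (y, r *\<^sub>R \<eta>) \<in> V))"

end

theory Submission
  imports Defs
begin

text \<open>Write \<open>p = x \<bullet> v(\<alpha>1)\<close>, \<open>q = y \<bullet> v(\<alpha>2)\<close>, and let \<open>s2'\<close>, \<open>\<alpha>2'\<close> be the derivatives of \<open>\<chi>\<close> along the
  lines through the fixed point \<open>x\<close>, i.e. \<open>d\<chi>\<close> applied to the column \<open>(-p, 1)\<close>.  Differentiating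
  \<open>l2 \<bullet> w(\<alpha>2) = s2\<close> shows that the \<open>w(\<alpha>2)\<close>-component of the derivative of \<open>l2\<close> in \<open>\<alpha>1\<close> at \<open>y\<close> is
  \<open>s2' + q \<alpha>2'\<close>, so conjugacy means that this number vanishes.  On the other hand, inverting the
  2 by 2 matrix \<open>d\<chi>\<close> turns \<open>(\<mu>, \<mu> p) = (\<kappa>, \<kappa> q) d\<chi>\<close> into \<open>\<kappa> det = \<mu> \<alpha>2'\<close> and \<open>\<kappa> q det = - \<mu> s2'\<close>,
  which is the same condition together with the formula for \<open>\<kappa>\<close>.  The neighborhoods are needed
  only to pin down the orientations of the two lines and to guarantee that \<open>x\<close> and \<open>y\<close> lie on the
  parts of the ray, and not merely on the lines carrying them.\<close>

section \<open>Lines and directions\<close>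

lemma vdir_wdir_simps [simp]:
  "vdir a \<bullet> vdir a = 1" "wdir a \<bullet> wdir a = 1" "vdir a \<bullet> wdir a = 0" "wdir a \<bullet> vdir a = 0"
  by (simp_all add: vdir_def wdir_def inner_vec_def sum_2 flip: power2_eq_square)

lemma wdir_nonzero [simp]: "wdir a \<noteq> 0"
  using vdir_wdir_simps(2)[of a] by force

lemma vdir_wdir_decomp: "x = (x \<bullet> vdir a) *\<^sub>R vdir a + (x \<bullet> wdir a) *\<^sub>R wdir a"
proof -
  \<comment> \<open>Expanding in coordinates with \<open>algebra_simps\<close> leaves the
    Pythagorean identity nested in this shape, with an arbitrary factor \<open>z\<close>.\<close>
  have "cos a * (cos a * z) + sin a * (sin a * z) = z" for z
    using sin_cos_squared_add3[of a] by (metis distrib_right mult.assoc mult_1)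
  note this [simp]
  show ?thesis
    by (simp add: vec_eq_iff forall_2 vdir_def wdir_def inner_vec_def sum_2 algebra_simps)
qed

lemma inner_wdir_wdir: "wdir a \<bullet> wdir b = cos (a - b)"
  and inner_wdir_vdir: "wdir a \<bullet> vdir b = - sin (a - b)"
  by (simp_all add: vdir_def wdir_def inner_vec_def sum_2 cos_diff sin_diff)

lemma has_derivative_vdir: "(vdir has_derivative (\<lambda>h. h *\<^sub>R wdir a)) (at a)"
proof (subst has_derivative_componentwise_within, intro ballI)
  fix i :: "real^2" assume "i \<in> Basis"
  then consider "i = axis 1 1" | "i = axis 2 1"
    by (auto simp: Basis_vec_def UNIV_2)
  then show "((\<lambda>a. vdir a \<bullet> i) has_derivative (\<lambda>h. (h *\<^sub>R wdir a) \<bullet> i)) (at a)"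
    by cases (auto simp: inner_axis wdir_def vdir_def algebra_simps intro!: derivative_eq_intros)
qed

lemma has_derivative_wdir: "(wdir has_derivative (\<lambda>h. h *\<^sub>R (- vdir a))) (at a)"
proof (subst has_derivative_componentwise_within, intro ballI)
  fix i :: "real^2" assume "i \<in> Basis"
  then consider "i = axis 1 1" | "i = axis 2 1"
    by (auto simp: Basis_vec_def UNIV_2)
  then show "((\<lambda>a. wdir a \<bullet> i) has_derivative (\<lambda>h. (h *\<^sub>R (- vdir a)) \<bullet> i)) (at a)"
    by cases (auto simp: inner_axis wdir_def vdir_def algebra_simps intro!: derivative_eq_intros)
qed

lemma has_vector_derivative_vdir_comp:
  assumes "(\<phi> has_real_derivative d) (at a)"
  shows "((\<lambda>a. vdir (\<phi> a)) has_vector_derivative d *\<^sub>R wdir (\<phi> a)) (at a)"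
  using has_derivative_compose[OF assms[unfolded has_field_derivative_def] has_derivative_vdir]
  by (simp add: has_vector_derivative_def mult.commute)

lemma has_vector_derivative_wdir_comp:
  assumes "(\<phi> has_real_derivative d) (at a)"
  shows "((\<lambda>a. wdir (\<phi> a)) has_vector_derivative - d *\<^sub>R vdir (\<phi> a)) (at a)"
  using has_derivative_compose[OF assms[unfolded has_field_derivative_def] has_derivative_wdir]
  by (simp add: has_vector_derivative_def mult.commute)

lemma continuous_on_vdir: "continuous_on S f \<Longrightarrow> continuous_on S (\<lambda>p. vdir (f p))"
  and continuous_on_wdir: "continuous_on S f \<Longrightarrow> continuous_on S (\<lambda>p. wdir (f p))"
proof -
  have "continuous_on UNIV vdir" "continuous_on UNIV wdir"
    using has_derivative_continuous[OF has_derivative_vdir]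
      has_derivative_continuous[OF has_derivative_wdir]
    by (simp_all add: continuous_on_eq_continuous_at)
  then show "continuous_on S f \<Longrightarrow> continuous_on S (\<lambda>p. vdir (f p))"
    "continuous_on S f \<Longrightarrow> continuous_on S (\<lambda>p. wdir (f p))"
    by (auto intro: continuous_on_compose2)
qed

lemma line_through_nth [simp]: "line_through x a $ 1 = x \<bullet> wdir a" "line_through x a $ 2 = a"
  by (simp_all add: line_through_def)

lemma line_through_mem: "x \<in> line (line_through x a)"
  by (simp add: line_def)

lemma continuous_on_line_through:
  assumes "continuous_on S f" "continuous_on S g"
  shows "continuous_on S (\<lambda>p. line_through (f p) (g p))"
proof -
  have eq: "line_through (f p) (g p) = (f p \<bullet> wdir (g p)) *\<^sub>R axis 1 1 + g p *\<^sub>R axis 2 1" for p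
    by (simp add: vec_eq_iff forall_2 axis_def)
  show ?thesis
    unfolding eq by (intro continuous_intros continuous_on_wdir assms)
qed

lemma line_point_eq:
  assumes "x \<in> line \<nu>" "e \<in> line \<nu>"
  shows "x = e + ((x - e) \<bullet> vdir (\<nu>$2)) *\<^sub>R vdir (\<nu>$2)"
  using vdir_wdir_decomp[of "x - e" "\<nu>$2"] assms by (simp add: line_def inner_diff_left algebra_simps)

lemma on_line_add: "e \<in> line \<nu> \<Longrightarrow> e + r *\<^sub>R vdir (\<nu>$2) \<in> line \<nu>"
  by (simp add: line_def inner_add_left)

text \<open>In the orthonormal frame \<open>vdir a\<close>, \<open>wdir a\<close> the map is
  triangular with diagonal entries 1 and \<open>m \<bullet> wdir a\<close>, so only the second can
  destroy invertibility.\<close>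

lemma bij_frame_iff:
  fixes m :: "real^2"
  shows "bij (\<lambda>(h1, h2). h1 *\<^sub>R vdir a + h2 *\<^sub>R m) \<longleftrightarrow> m \<bullet> wdir a \<noteq> 0" (is "bij ?f \<longleftrightarrow> _")
proof
  assume "bij ?f"
  from surjD[OF bij_is_surj[OF this], of "wdir a"] obtain p where "wdir a = ?f p" ..
  then have "?f p \<bullet> wdir a = 1" by (metis vdir_wdir_simps(2))
  then show "m \<bullet> wdir a \<noteq> 0" by (auto simp: split_beta inner_add_left)
next
  assume m: "m \<bullet> wdir a \<noteq> 0"
  \<comment> \<open>Back substitution: the \<open>wdir a\<close> component determines
    \<open>h2\<close>, and subtracting \<open>h2 * (m \<bullet> vdir a)\<close> from the
    \<open>vdir a\<close> component leaves \<open>h1\<close>.\<close>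
  let ?g = "\<lambda>z. (z \<bullet> vdir a - z \<bullet> wdir a / (m \<bullet> wdir a) * (m \<bullet> vdir a), z \<bullet> wdir a / (m \<bullet> wdir a))"
  show "bij ?f"
  proof (rule o_bij[of ?g])
    show "?g \<circ> ?f = id"
      using m by (auto simp: fun_eq_iff inner_add_left)
    show "?f \<circ> ?g = id"
    proof
      fix z
      let ?u = "?f (?g z)"
      have "?u \<bullet> vdir a = z \<bullet> vdir a" "?u \<bullet> wdir a = z \<bullet> wdir a"
        using m by (auto simp: inner_add_left)
      then show "(?f \<circ> ?g) z = id z"
        using vdir_wdir_decomp[of ?u a] vdir_wdir_decomp[of z a] by simp
    qed
  qed
qed

text \<open>Turning a line about the fixed point \<open>x\<close> moves its coordinates with
  velocity (-p, 1), since the derivative of w is -v. The chain rule carries this to the quantities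
  attached to a ray: \<open>chi B\<close>, \<open>out_start B\<close> and
  \<open>out_time B\<close>.\<close>

lemma line_through_comp_has_vector_derivative:
  fixes f :: "real^2 \<Rightarrow> 'b::real_normed_vector"
  assumes "f differentiable (at \<nu>)" "x \<in> line \<nu>"
  shows "((\<lambda>a. f (line_through x a)) has_vector_derivative
    frechet_derivative f (at \<nu>) (vector [- (x \<bullet> vdir (\<nu>$2)), 1])) (at (\<nu>$2))"
proof -
  have f: "(f has_derivative frechet_derivative f (at \<nu>)) (at (line_through x (\<nu>$2)))"
    using assms by (simp add: line_through_eq frechet_derivative_works[symmetric])
  have "linear (frechet_derivative f (at \<nu>))"
    using assms(1) by (rule linear_frechet_derivative)
  then show ?thesis
    using has_derivative_compose[OF line_through_has_derivative f]
    by (simp add: has_vector_derivative_def linear_cmul)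
qed


section \<open>Smooth maps and the family of broken rays\<close>

lemma smooth_on_differentiable: "smooth_on f S \<Longrightarrow> x \<in> S \<Longrightarrow> f differentiable (at x)"
  unfolding smooth_on_def by (metis Ck_on.simps(2))

lemma smooth_on_continuous: "smooth_on f S \<Longrightarrow> continuous_on S f"
  unfolding smooth_on_def by (metis Ck_on.simps(1))

text \<open>The chain rule for the inverse after \<open>f\<close> provides a left inverse of the
  Jacobian, which suffices for a square matrix. This justifies dividing by det(d\<chi>).\<close>

lemma diffeomorphism_on_det_jacobian:
  fixes f :: "real^'n \<Rightarrow> real^'n"
  assumes "diffeomorphism_on f S T" "x \<in> S"
  shows "det (jacobian f (at x)) \<noteq> 0"
proof -
  have S: "open S" "bij_betw f S T" "smooth_on f S" "smooth_on (inv_into S f) T"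
    using assms(1) by (auto simp: diffeomorphism_on_def)
  have fx: "f x \<in> T" using S(2) assms(2) by (auto simp: bij_betw_def)
  define J where "J = jacobian f (at x)"
  define K where "K = jacobian (inv_into S f) (at (f x))"
  have 1: "(f has_derivative ((*v) J)) (at x)"
    using smooth_on_differentiable[OF S(3) assms(2)] by (simp add: J_def jacobian_works)
  have 2: "(inv_into S f has_derivative ((*v) K)) (at (f x))"
    using smooth_on_differentiable[OF S(4) fx] by (simp add: K_def jacobian_works)
  \<comment> \<open>The composite is the identity only on \<open>S\<close>; as \<open>S\<close> is
    open, this determines its derivative at \<open>x\<close>.\<close>
  have "((\<lambda>y. y) has_derivative (\<lambda>h. K *v (J *v h))) (at x)"
    by (rule has_derivative_transform_within_open[OF has_derivative_compose[OF 1 2] S(1) assms(2)])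
      (use S(2) in \<open>auto simp: bij_betw_def inv_into_f_f\<close>)
  then have "(\<lambda>h. h) = (\<lambda>h. K *v (J *v h))"
    by (rule has_derivative_unique[OF has_derivative_ident])
  then have "K ** J = mat 1"
    by (simp add: matrix_eq matrix_vector_mul_assoc[symmetric] matrix_vector_mul_lid) metis
  then show ?thesis
    by (metis J_def invertible_def matrix_left_right_inverse invertible_det_nz)
qed

context
  fixes B :: rays
  assumes B: "broken_ray_family B"
begin

lemma family_facts:
  shows "diffeomorphism_on (chi B) (dom_in B) (dom_out B)"
    and "open (dom_in B)" "open (dom_out B)" "bij_betw (chi B) (dom_in B) (dom_out B)"
    and "smooth_on (chi B) (dom_in B)" "smooth_on (inv_into (dom_in B) (chi B)) (dom_out B)"
    and "smooth_on (in_end B) (dom_in B)" "smooth_on (out_start B) (dom_in B)"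
    and "smooth_on (out_time B) (dom_in B)"
    and "continuous_on (dom_in B) (in_len B)" "continuous_on (dom_in B) (out_len B)"
  using B by (auto simp: broken_ray_family_def diffeomorphism_on_def)

lemma in_end_mem: "\<nu> \<in> dom_in B \<Longrightarrow> in_end B \<nu> \<in> line \<nu>"
  and out_start_mem: "\<nu> \<in> dom_in B \<Longrightarrow> out_start B \<nu> \<in> line (chi B \<nu>)"
  using B by (auto simp: broken_ray_family_def)

text \<open>The signs \<open>- 1\<close> and \<open>1\<close> below are the two values of \<open>\<sigma>\<close> to which \<open>conic_nbhd_lines\<close> is applied.\<close>

lemma incoming_iff:
  assumes "\<nu> \<in> dom_in B"
  shows "x \<in> incoming B \<nu> \<longleftrightarrow> x \<in> line \<nu> \<and> 0 < - 1 * ((x - in_end B \<nu>) \<bullet> vdir (\<nu>$2)) \<and>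
    ereal (- 1 * ((x - in_end B \<nu>) \<bullet> vdir (\<nu>$2))) < in_len B \<nu>" (is "_ \<longleftrightarrow> ?R")
proof
  assume "x \<in> incoming B \<nu>"
  then obtain r where r: "x = in_end B \<nu> - r *\<^sub>R vdir (\<nu>$2)" "0 < r" "ereal r < in_len B \<nu>"
    unfolding incoming_def by blast
  then show ?R
    using on_line_add[OF in_end_mem[OF assms], of "-r"] by simp
next
  assume ?R
  moreover from this have "x = in_end B \<nu> - (- 1 * ((x - in_end B \<nu>) \<bullet> vdir (\<nu>$2))) *\<^sub>R vdir (\<nu>$2)"
    using line_point_eq[OF _ in_end_mem[OF assms]] by simp
  ultimately show "x \<in> incoming B \<nu>"
    unfolding incoming_def by blast
qed

lemma outgoing_iff:
  assumes "\<nu> \<in> dom_in B"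
  shows "y \<in> outgoing B \<nu> \<longleftrightarrow> y \<in> line (chi B \<nu>) \<and>
    0 < 1 * ((y - out_start B \<nu>) \<bullet> vdir (chi B \<nu> $ 2)) \<and>
    ereal (1 * ((y - out_start B \<nu>) \<bullet> vdir (chi B \<nu> $ 2))) < out_len B \<nu>" (is "_ \<longleftrightarrow> ?R")
proof
  assume "y \<in> outgoing B \<nu>"
  then obtain t where "y = l2 B \<nu> t" "out_time B \<nu> < t" "ereal (t - out_time B \<nu>) < out_len B \<nu>"
    unfolding outgoing_def by blast
  then show ?R
    using on_line_add[OF out_start_mem[OF assms], of "t - out_time B \<nu>"] by (simp add: l2_def)
next
  assume R: ?R
  define t where "t = out_time B \<nu> + (y - out_start B \<nu>) \<bullet> vdir (chi B \<nu> $ 2)"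
  have "y = l2 B \<nu> t"
    using R line_point_eq[OF _ out_start_mem[OF assms]] by (simp add: l2_def t_def)
  moreover have "out_time B \<nu> < t" "ereal (t - out_time B \<nu>) < out_len B \<nu>"
    using R by (simp_all add: t_def)
  ultimately show "y \<in> outgoing B \<nu>"
    unfolding outgoing_def by blast
qed


section \<open>Conjugate points in terms of the Jacobian\<close>

lemma chi_line_through_derivatives:
  assumes "\<nu> \<in> dom_in B" "x \<in> line \<nu>"
  shows "((\<lambda>a. chi B (line_through x a) $ i) has_real_derivative
    d\<chi> B \<nu> $ i $ 2 - (x \<bullet> vdir (\<nu>$2)) * d\<chi> B \<nu> $ i $ 1) (at (\<nu>$2))"
proof -
  have diff: "chi B differentiable (at \<nu>)"
    using smooth_on_differentiable family_facts(5) assms(1) by blast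
  then have "frechet_derivative (chi B) (at \<nu>) = (*v) (d\<chi> B \<nu>)"
    using frechet_derivative_at jacobian_works unfolding d\<chi>_def by metis
  from line_through_comp_has_vector_derivative[OF diff assms(2), unfolded this,
      THEN bounded_linear.has_vector_derivative[OF bounded_linear_vec_nth, of _ _ _ i]]
  show ?thesis
    by (simp add: has_real_derivative_iff_has_vector_derivative matrix_vector_mult_def sum_2
        algebra_simps)
qed

text \<open>The derivative of \<open>l2\<close> in time is the direction v(\<alpha>2), so
  \<open>bij_frame_iff\<close> reduces conjugacy to the w(\<alpha>2) component of the angular
  derivative. Moving the start along its line or resetting the clock only reparametrizes each
  outgoing line, which is why \<open>out_start\<close> and \<open>out_time\<close> do not survive in
  the formula.\<close>

lemma conjugate_along_iff:
  assumes \<nu>: "\<nu> \<in> dom_in B" and x: "x \<in> line \<nu>" and y: "y \<in> line (chi B \<nu>)"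
  shows "conjugate_along B \<nu> x y \<longleftrightarrow>
    d\<chi> B \<nu> $ 1 $ 2 - (x \<bullet> vdir (\<nu>$2)) * d\<chi> B \<nu> $ 1 $ 1 +
    (y \<bullet> vdir (chi B \<nu> $ 2)) * (d\<chi> B \<nu> $ 2 $ 2 - (x \<bullet> vdir (\<nu>$2)) * d\<chi> B \<nu> $ 2 $ 1) = 0"
proof -
  define a0 where "a0 = \<nu> $ 2"
  define G where "G = (\<lambda>a. out_start B (line_through x a))"
  define T where "T = (\<lambda>a. out_time B (line_through x a))"
  define s where "s = (\<lambda>a. chi B (line_through x a) $ 1)"
  define \<phi> where "\<phi> = (\<lambda>a. chi B (line_through x a) $ 2)"
  define s' where "s' = d\<chi> B \<nu> $ 1 $ 2 - (x \<bullet> vdir (\<nu>$2)) * d\<chi> B \<nu> $ 1 $ 1"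
  define \<phi>' where "\<phi>' = d\<chi> B \<nu> $ 2 $ 2 - (x \<bullet> vdir (\<nu>$2)) * d\<chi> B \<nu> $ 2 $ 1"
  have at0 [simp]: "line_through x a0 = \<nu>"
    using line_through_eq[OF x] by (simp add: a0_def)
  have ds: "(s has_real_derivative s') (at a0)" and d\<phi>: "(\<phi> has_real_derivative \<phi>') (at a0)"
    using chi_line_through_derivatives[OF \<nu> x]
    by (auto simp: s_def \<phi>_def s'_def \<phi>'_def a0_def)
  obtain g where dG: "(G has_vector_derivative g) (at a0)"
    using line_through_comp_has_vector_derivative[OF smooth_on_differentiable[OF family_facts(8) \<nu>] x]
    by (auto simp: G_def a0_def)
  obtain T' where dT: "(T has_real_derivative T') (at a0)"
    using line_through_comp_has_vector_derivative[OF smooth_on_differentiable[OF family_facts(9) \<nu>] x]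
    by (auto simp: T_def a0_def has_real_derivative_iff_has_vector_derivative)
  \<comment> \<open>The normal component of the velocity \<open>g\<close> is forced by the
    constraint that \<open>G a\<close> lies on the outgoing line, differentiated in two ways. The
    tangential component remains unknown and does not enter the criterion.\<close>
  have g: "g \<bullet> wdir (\<phi> a0) = s' + (G a0 \<bullet> vdir (\<phi> a0)) * \<phi>'"
  proof -
    have "((\<lambda>a. G a \<bullet> wdir (\<phi> a)) has_vector_derivative
        G a0 \<bullet> (- \<phi>' *\<^sub>R vdir (\<phi> a0)) + g \<bullet> wdir (\<phi> a0)) (at a0)"
      by (rule bounded_bilinear.has_vector_derivative[OF bounded_bilinear_inner dG
            has_vector_derivative_wdir_comp[OF d\<phi>]])
    \<comment> \<open>The constraint holds only for angles at which the line through
      \<open>x\<close> belongs to the family; they form an open set containing \<open>a0\<close>, so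
      the derivative can be transferred.\<close>
    moreover have "open {a. line_through x a \<in> dom_in B}"
      using open_vimage[OF family_facts(2)
          continuous_on_line_through[OF continuous_on_const[of UNIV x] continuous_on_id]]
      by (simp add: vimage_def)
    then have "((\<lambda>a. G a \<bullet> wdir (\<phi> a)) has_vector_derivative s') (at a0)"
    proof (rule has_vector_derivative_transform_within_open[rotated])
      show "(s has_vector_derivative s') (at a0)"
        using ds by (simp add: has_real_derivative_iff_has_vector_derivative)
    qed (use \<nu> out_start_mem in \<open>auto simp: G_def \<phi>_def s_def line_def\<close>)
    ultimately have "G a0 \<bullet> (- \<phi>' *\<^sub>R vdir (\<phi> a0)) + g \<bullet> wdir (\<phi> a0) = s'"
      by (rule vector_derivative_unique_at)
    then show ?thesis by (simp add: algebra_simps)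
  qed
  have frechet: "frechet_derivative (\<lambda>(t, a). l2 B (line_through x a) t) (at (t, a0)) =
      (\<lambda>(h1, h2). h1 *\<^sub>R vdir (\<phi> a0) +
         h2 *\<^sub>R (g - T' *\<^sub>R vdir (\<phi> a0) + ((t - T a0) * \<phi>') *\<^sub>R wdir (\<phi> a0)))"
    (is "_ = ?D") for t
  proof -
    have snd_comp: "((\<lambda>p::real \<times> real. f (snd p)) has_derivative (\<lambda>p. snd p *\<^sub>R d)) (at (t, a0))"
      if "(f has_vector_derivative d) (at a0)" for f :: "real \<Rightarrow> 'c::real_normed_vector" and d
    proof -
      have "(f has_derivative (\<lambda>h. h *\<^sub>R d)) (at (snd (t, a0)))"
        using that by (simp add: has_vector_derivative_def)
      from has_derivative_compose[OF has_derivative_snd[OF has_derivative_ident] this]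
      show ?thesis by simp
    qed
    have "((\<lambda>p. G (snd p) + (fst p - T (snd p)) *\<^sub>R vdir (\<phi> (snd p))) has_derivative
        (\<lambda>p. snd p *\<^sub>R g + ((fst (t, a0) - T (snd (t, a0))) *\<^sub>R (snd p *\<^sub>R (\<phi>' *\<^sub>R wdir (\<phi> a0))) +
           (fst p - snd p *\<^sub>R T') *\<^sub>R vdir (\<phi> (snd (t, a0)))))) (at (t, a0))"
      by (intro has_derivative_add has_derivative_scaleR has_derivative_diff snd_comp
          has_derivative_fst has_derivative_ident dG
          has_vector_derivative_vdir_comp[OF d\<phi>]
          dT[unfolded has_real_derivative_iff_has_vector_derivative])
    moreover have "(\<lambda>p. G (snd p) + (fst p - T (snd p)) *\<^sub>R vdir (\<phi> (snd p))) =
        (\<lambda>(t, a). l2 B (line_through x a) t)"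
      by (auto simp: G_def T_def \<phi>_def l2_def)
    ultimately have "((\<lambda>(t, a). l2 B (line_through x a) t) has_derivative ?D) (at (t, a0))"
      by (auto elim!: has_derivative_eq_rhs simp: algebra_simps)
    then show ?thesis
      by (simp add: frechet_derivative_at[symmetric])
  qed
  have key: "\<not> bij (frechet_derivative (\<lambda>(t, a). l2 B (line_through x a) t) (at (t, a0))) \<longleftrightarrow>
      s' + (y \<bullet> vdir (\<phi> a0)) * \<phi>' = 0" if "y = l2 B \<nu> t" for t
  proof -
    \<comment> \<open>The elapsed time \<open>t - T a0\<close> turns the tangential coordinate of
      the start into that of \<open>y\<close>, which removes every trace of \<open>t\<close> from
      the criterion.\<close>
    have y_vdir: "y \<bullet> vdir (\<phi> a0) = G a0 \<bullet> vdir (\<phi> a0) + (t - T a0)"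
      using that by (simp add: l2_def G_def T_def \<phi>_def inner_add_left)
    show ?thesis
      unfolding frechet bij_frame_iff y_vdir
      by (simp add: inner_add_left inner_diff_left g algebra_simps)
  qed
  \<comment> \<open>All real times are allowed here, so \<open>l2\<close> sweeps the whole line; the
    witness adds the signed distance from the start to \<open>out_time B \<nu>\<close>. By
    \<open>key\<close> the criterion is the same for every such \<open>t\<close>.\<close>
  have "\<exists>t. y = l2 B \<nu> t"
    using line_point_eq[OF y out_start_mem[OF \<nu>]]
    by (intro exI[of _ "out_time B \<nu> + (y - out_start B \<nu>) \<bullet> vdir (chi B \<nu> $ 2)"])
      (simp add: l2_def)
  then have "conjugate_along B \<nu> x y \<longleftrightarrow> s' + (y \<bullet> vdir (\<phi> a0)) * \<phi>' = 0"
    unfolding conjugate_along_def a0_def[symmetric] using key by blast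
  then show ?thesis
    by (simp add: s'_def \<phi>'_def \<phi>_def)
qed

text \<open>These are two scalar equations for the single unknown \<kappa>: one determines it, the
  other becomes the solvability condition, which is conjugacy.\<close>

lemma covector_eq_iff:
  assumes \<nu>: "\<nu> \<in> dom_in B" and x: "x \<in> line \<nu>" and y: "y \<in> line (chi B \<nu>)" and "\<mu> \<noteq> 0"
  shows "vector [\<mu>, \<mu> * (vdir (\<nu>$2) \<bullet> x)] =
      vector [\<kappa>, \<kappa> * (vdir (chi B \<nu> $ 2) \<bullet> y)] v* d\<chi> B \<nu> \<longleftrightarrow>
    conjugate_along B \<nu> x y \<and> \<kappa> = \<mu> / det (d\<chi> B \<nu>) * d\<alpha>2_d\<alpha>1 B x (\<nu>$2)"
proof -
  define p where "p = x \<bullet> vdir (\<nu>$2)"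
  define q where "q = y \<bullet> vdir (chi B \<nu> $ 2)"
  define a where "a = d\<chi> B \<nu> $ 1 $ 1"
  define b where "b = d\<chi> B \<nu> $ 1 $ 2"
  define c where "c = d\<chi> B \<nu> $ 2 $ 1"
  define d where "d = d\<chi> B \<nu> $ 2 $ 2"
  define D where "D = a * d - b * c"
  have D: "det (d\<chi> B \<nu>) = D" "D \<noteq> 0"
    using diffeomorphism_on_det_jacobian[OF family_facts(1) \<nu>]
    by (simp_all add: det_2 D_def a_def b_def c_def d_def d\<chi>_def)
  have "vector [\<mu>, \<mu> * (vdir (\<nu>$2) \<bullet> x)] =
      vector [\<kappa>, \<kappa> * (vdir (chi B \<nu> $ 2) \<bullet> y)] v* d\<chi> B \<nu> \<longleftrightarrow>
      \<mu> = \<kappa> * (a + q * c) \<and> \<mu> * p = \<kappa> * (b + q * d)"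
    by (simp add: vec_eq_iff forall_2 vector_matrix_mult_def sum_2 inner_commute
        a_def b_def c_def d_def p_def q_def algebra_simps)
  \<comment> \<open>Cramer's rule: both sides are multiplied by the adjugate of d\<chi>, and
    \<open>D \<noteq> 0\<close> makes this reversible.\<close>
  also have "\<dots> \<longleftrightarrow> \<kappa> * D = \<mu> * (d - p * c) \<and> \<kappa> * q * D = \<mu> * (a * p - b)"
  proof (intro iffI conjI)
    assume *: "\<mu> = \<kappa> * (a + q * c) \<and> \<mu> * p = \<kappa> * (b + q * d)"
    have "\<mu> * (d - p * c) = \<mu> * d - (\<mu> * p) * c" by algebra
    also have "\<dots> = \<kappa> * (a + q * c) * d - \<kappa> * (b + q * d) * c" using * by metis
    finally show "\<kappa> * D = \<mu> * (d - p * c)" by (simp add: D_def algebra_simps)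
    have "\<mu> * (a * p - b) = (\<mu> * p) * a - \<mu> * b" by algebra
    also have "\<dots> = \<kappa> * (b + q * d) * a - \<kappa> * (a + q * c) * b" using * by metis
    finally show "\<kappa> * q * D = \<mu> * (a * p - b)" by (simp add: D_def algebra_simps)
  next
    assume *: "\<kappa> * D = \<mu> * (d - p * c) \<and> \<kappa> * q * D = \<mu> * (a * p - b)"
    have "\<kappa> * (a + q * c) * D = (\<kappa> * D) * a + (\<kappa> * q * D) * c" by algebra
    also have "\<dots> = \<mu> * (d - p * c) * a + \<mu> * (a * p - b) * c" using * by simp
    also have "\<dots> = \<mu> * D" by (simp add: D_def algebra_simps)
    finally show "\<mu> = \<kappa> * (a + q * c)" using D by simp
    have "\<kappa> * (b + q * d) * D = (\<kappa> * D) * b + (\<kappa> * q * D) * d" by algebra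
    also have "\<dots> = \<mu> * (d - p * c) * b + \<mu> * (a * p - b) * d" using * by simp
    also have "\<dots> = \<mu> * p * D" by (simp add: D_def algebra_simps)
    finally show "\<mu> * p = \<kappa> * (b + q * d)" using D by simp
  qed
  also have "\<dots> \<longleftrightarrow> b - p * a + q * (d - p * c) = 0 \<and> \<kappa> = \<mu> / D * (d - p * c)"
  proof -
    have "\<kappa> * D = \<mu> * (d - p * c) \<longleftrightarrow> \<kappa> = \<mu> / D * (d - p * c)"
      using D by (simp add: field_simps)
    \<comment> \<open>This equivalence holds only modulo the first equation: eliminating
      \<open>\<kappa> * D\<close> leaves \<mu> times the conjugacy expression, and \<mu>
      cancels.\<close>
    moreover have "\<kappa> * q * D = \<mu> * (a * p - b) \<longleftrightarrow> b - p * a + q * (d - p * c) = 0"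
      if "\<kappa> * D = \<mu> * (d - p * c)"
    proof -
      have "\<kappa> * q * D - \<mu> * (a * p - b) = \<mu> * (b - p * a + q * (d - p * c))"
        using that by algebra
      then show ?thesis
        using \<open>\<mu> \<noteq> 0\<close> by (metis eq_iff_diff_eq_0 mult_eq_0_iff)
    qed
    ultimately show ?thesis by blast
  qed
  finally show ?thesis
    using conjugate_along_iff[OF \<nu> x y] d\<alpha>2_d\<alpha>1_eq[OF B \<nu> x] D(1)
    by (simp add: a_def b_def c_def d_def p_def q_def)
qed

end


section \<open>Conic neighborhoods\<close>

text \<open>The quotient of the two frame components is minus the tangent of the angle difference,
  and the factor \<mu>, of either sign, cancels. Hence the angle is an explicit continuous function
  of the covector, homogeneous of degree 0.\<close>

lemma wdir_angle_eq:
  assumes "\<mu> \<noteq> 0" "\<bar>\<alpha> - \<alpha>0\<bar> < pi / 2"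
  shows "(\<mu> *\<^sub>R wdir \<alpha>) \<bullet> wdir \<alpha>0 \<noteq> 0"
    and "\<alpha> = \<alpha>0 - arctan (((\<mu> *\<^sub>R wdir \<alpha>) \<bullet> vdir \<alpha>0) / ((\<mu> *\<^sub>R wdir \<alpha>) \<bullet> wdir \<alpha>0))"
proof -
  have *: "- (pi / 2) < \<alpha> - \<alpha>0" "\<alpha> - \<alpha>0 < pi / 2" using assms(2) by linarith+
  then have "cos (\<alpha> - \<alpha>0) > 0" by (intro cos_gt_zero_pi) auto
  then show "(\<mu> *\<^sub>R wdir \<alpha>) \<bullet> wdir \<alpha>0 \<noteq> 0"
    using assms(1) by (simp add: inner_wdir_wdir)
  have "((\<mu> *\<^sub>R wdir \<alpha>) \<bullet> vdir \<alpha>0) / ((\<mu> *\<^sub>R wdir \<alpha>) \<bullet> wdir \<alpha>0) = - tan (\<alpha> - \<alpha>0)"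
    using assms(1) by (simp add: inner_wdir_wdir inner_wdir_vdir tan_def)
  then show "\<alpha> = \<alpha>0 - arctan (((\<mu> *\<^sub>R wdir \<alpha>) \<bullet> vdir \<alpha>0) / ((\<mu> *\<^sub>R wdir \<alpha>) \<bullet> wdir \<alpha>0))"
    using arctan_tan[OF *] by (simp add: arctan_minus)
qed

text \<open>The open window of width \<pi> contains only one orientation of a line, excluding the
  reversed angle with -\<mu> and all shifts by full turns.\<close>

lemma wdir_angle_unique:
  assumes "\<mu> *\<^sub>R wdir \<alpha> = \<mu>' *\<^sub>R wdir \<alpha>'" "\<mu> \<noteq> 0" "\<mu>' \<noteq> 0"
    "\<bar>\<alpha> - \<alpha>0\<bar> < pi / 2" "\<bar>\<alpha>' - \<alpha>0\<bar> < pi / 2"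
  shows "\<alpha> = \<alpha>'" "\<mu> = \<mu>'"
proof -
  show "\<alpha> = \<alpha>'"
    using wdir_angle_eq(2)[of \<mu> \<alpha> \<alpha>0] wdir_angle_eq(2)[of \<mu>' \<alpha>' \<alpha>0] assms by simp
  then show "\<mu> = \<mu>'" using assms(1) by simp
qed

text \<open>A covector near \<open>\<xi>0\<close> selects a line through its base point depending
  continuously on both. Lying in \<open>D\<close> and on the correct bounded or unbounded part of
  the line is therefore an open condition, invariant under positive scaling. Here \<open>e\<close>
  is the end of the part adjacent to the connection, \<open>L\<close> its length, and \<sigma> tells
  on which side of \<open>e\<close> it extends.\<close>

lemma conic_nbhd_lines:
  fixes e :: "real^2 \<Rightarrow> real^2" and L :: "real^2 \<Rightarrow> ereal" and \<sigma> :: real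
  assumes D: "open D" "\<nu>0 \<in> D" and e: "continuous_on D e" and L: "continuous_on D L"
    and \<xi>0: "\<xi>0 \<noteq> 0" "\<xi>0 \<bullet> vdir (\<nu>0$2) = 0" and x0: "x0 \<in> line \<nu>0"
      "0 < \<sigma> * ((x0 - e \<nu>0) \<bullet> vdir (\<nu>0$2))"
      "ereal (\<sigma> * ((x0 - e \<nu>0) \<bullet> vdir (\<nu>0$2))) < L \<nu>0"
  obtains W where "conic_nbhd x0 \<xi>0 W"
    and "\<And>x \<mu> \<alpha>. (x, \<mu> *\<^sub>R wdir \<alpha>) \<in> W \<Longrightarrow> \<mu> \<noteq> 0 \<Longrightarrow> \<bar>\<alpha> - \<nu>0$2\<bar> < pi / 2 \<Longrightarrow>
      line_through x \<alpha> \<in> D \<and> 0 < \<sigma> * ((x - e (line_through x \<alpha>)) \<bullet> vdir \<alpha>) \<and>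
      ereal (\<sigma> * ((x - e (line_through x \<alpha>)) \<bullet> vdir \<alpha>)) < L (line_through x \<alpha>)"
proof -
  define \<alpha>0 where "\<alpha>0 = \<nu>0$2"
  define A where "A = (\<lambda>\<xi>. \<alpha>0 - arctan ((\<xi> \<bullet> vdir \<alpha>0) / (\<xi> \<bullet> wdir \<alpha>0)))"
  define N where "N = (\<lambda>p. line_through (fst p) (A (snd p)))"
  define r where "r = (\<lambda>p. \<sigma> * ((fst p - e (N p)) \<bullet> vdir (A (snd p))))"
  \<comment> \<open>On \<open>S\<close> the quotient inside \<open>A\<close> is continuous;
    \<open>S\<close> also excludes zero covectors, as a conic neighborhood requires.\<close>
  define S where "S = {p::phase. snd p \<bullet> wdir \<alpha>0 \<noteq> 0}"
  define S' where "S' = S \<inter> N -` D"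
  define W where "W = S' \<inter> (\<lambda>p. (ereal (r p), L (N p))) -` {(u, v). 0 < u \<and> u < v}"
  have contA: "continuous_on S (\<lambda>p. A (snd p))"
    unfolding A_def S_def by (intro continuous_intros) auto
  have contN: "continuous_on S N"
    unfolding N_def by (intro continuous_on_line_through contA continuous_intros)
  have "open S"
    unfolding S_def by (intro open_Collect_neq continuous_intros)
  then have S': "open S'"
    unfolding S'_def by (rule continuous_open_preimage[OF contN _ D(1)])
  have sub: "S' \<subseteq> S" "N ` S' \<subseteq> D" by (auto simp: S'_def)
  have contN': "continuous_on S' N" "continuous_on S' (\<lambda>p. A (snd p))"
    using contN contA sub(1) by (auto intro: continuous_on_subset)
  have contr: "continuous_on S' (\<lambda>p. ereal (r p))"
    unfolding r_def
    by (intro continuous_intros continuous_on_vdir contN' continuous_on_compose2[OF e contN'(1) sub(2)])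
  have op: "open {(u::ereal, v). 0 < u \<and> u < v}"
  proof -
    have "open ({p::ereal \<times> ereal. 0 < fst p} \<inter> {p. fst p < snd p})"
      by (intro open_Int open_Collect_less continuous_intros)
    moreover have "{p::ereal \<times> ereal. 0 < fst p} \<inter> {p. fst p < snd p} = {(u, v). 0 < u \<and> u < v}"
      by auto
    ultimately show ?thesis by simp
  qed
  have openW: "open W"
    unfolding W_def
    by (intro continuous_open_preimage[OF _ S' op] continuous_on_Pair contr
        continuous_on_compose2[OF L contN'(1) sub(2)])
  \<comment> \<open>Being conormal, \<open>\<xi>0\<close> has only a w component, so that component
    is nonzero and the arctangent in \<open>A\<close> vanishes.\<close>
  have "\<xi>0 = (\<xi>0 \<bullet> wdir \<alpha>0) *\<^sub>R wdir \<alpha>0"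
    using vdir_wdir_decomp[of \<xi>0 \<alpha>0] \<xi>0 by (simp add: \<alpha>0_def)
  then have "\<xi>0 \<bullet> wdir \<alpha>0 \<noteq> 0" using \<xi>0(1) by force
  moreover have A0: "A \<xi>0 = \<alpha>0" using \<xi>0 by (simp add: A_def \<alpha>0_def)
  moreover have N0: "N (x0, \<xi>0) = \<nu>0"
    using line_through_eq[OF x0(1)] by (simp add: N_def A0 \<alpha>0_def)
  ultimately have memW: "(x0, \<xi>0) \<in> W"
    using D x0 by (auto simp: W_def S'_def S_def r_def A0 N0 \<alpha>0_def)
  \<comment> \<open>The covector enters \<open>W\<close> only through the angle \<open>A\<close> and
    the nonvanishing of its w component, both unaffected by a positive factor.\<close>
  have scale: "(y, t *\<^sub>R \<eta>) \<in> W" if "(y, \<eta>) \<in> W" "t > 0" for y \<eta> t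
  proof -
    have "A (t *\<^sub>R \<eta>) = A \<eta>" using that(2) by (simp add: A_def)
    then show ?thesis
      using that by (simp add: W_def S'_def S_def N_def r_def)
  qed
  have nz: "\<eta> \<noteq> 0" if "(y, \<eta>) \<in> W" for y \<eta>
    using that by (auto simp: W_def S'_def S_def)
  show thesis
  proof (rule that)
    show "conic_nbhd x0 \<xi>0 W"
      unfolding conic_nbhd_def using openW memW scale nz by blast
  next
    fix x \<mu> \<alpha> assume *: "(x, \<mu> *\<^sub>R wdir \<alpha>) \<in> W" "\<mu> \<noteq> 0" "\<bar>\<alpha> - \<nu>0$2\<bar> < pi / 2"
    then have "A (\<mu> *\<^sub>R wdir \<alpha>) = \<alpha>"
      using wdir_angle_eq(2)[of \<mu> \<alpha> \<alpha>0] by (simp add: A_def \<alpha>0_def)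
    then show "line_through x \<alpha> \<in> D \<and> 0 < \<sigma> * ((x - e (line_through x \<alpha>)) \<bullet> vdir \<alpha>) \<and>
      ereal (\<sigma> * ((x - e (line_through x \<alpha>)) \<bullet> vdir \<alpha>)) < L (line_through x \<alpha>)"
      using *(1) by (auto simp: W_def S'_def N_def r_def)
  qed
qed


section \<open>The canonical relations\<close>

lemma mem_C_R_iff:
  "((y, \<eta>), q) \<in> C_R \<alpha>0 \<longleftrightarrow> (\<exists>\<mu> \<alpha>. \<mu> \<noteq> 0 \<and> \<bar>\<alpha> - \<alpha>0\<bar> < pi / 2 \<and>
     \<eta> = \<mu> *\<^sub>R wdir \<alpha> \<and> q = (line_through y \<alpha>, vector [\<mu>, \<mu> * (vdir \<alpha> \<bullet> y)]))"
  unfolding C_R_def line_through_def mem_Collect_eq prod.inject by blast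

lemma mem_C_pullback_iff:
  "((\<nu>', \<theta>), q) \<in> C_pullback B \<longleftrightarrow> (\<exists>\<nu>\<in>dom_in B. chi B \<nu> = \<nu>' \<and> q = (\<nu>, \<theta> v* d\<chi> B \<nu>))"
  unfolding C_pullback_def mem_Collect_eq prod.inject by blast

lemma mem_C1_iff:
  "((x, \<xi>), q) \<in> C1 \<nu>0 V \<longleftrightarrow> (x, \<xi>) \<in> V \<and> (\<exists>\<mu> \<alpha>. \<mu> \<noteq> 0 \<and> \<bar>\<alpha> - \<nu>0$2\<bar> < pi / 2 \<and>
     \<xi> = \<mu> *\<^sub>R wdir \<alpha> \<and> q = (line_through x \<alpha>, vector [\<mu>, \<mu> * (vdir \<alpha> \<bullet> x)]))"
  unfolding C1_def mem_Collect_eq prod.case mem_C_R_iff by blast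

lemma mem_C2_iff:
  "((y, \<eta>), q) \<in> C2 B \<nu>0 V \<longleftrightarrow> (y, \<eta>) \<in> V \<and> (\<exists>\<kappa> \<beta> \<nu>. \<kappa> \<noteq> 0 \<and> \<bar>\<beta> - chi B \<nu>0 $ 2\<bar> < pi / 2 \<and>
     \<eta> = \<kappa> *\<^sub>R wdir \<beta> \<and> \<nu> \<in> dom_in B \<and> chi B \<nu> = line_through y \<beta> \<and>
     q = (\<nu>, vector [\<kappa>, \<kappa> * (vdir \<beta> \<bullet> y)] v* d\<chi> B \<nu>))" (is "?L \<longleftrightarrow> ?R")
proof
  assume ?L
  then obtain p where "(y, \<eta>) \<in> V" "((y, \<eta>), p) \<in> C_R (chi B \<nu>0 $ 2)" "(p, q) \<in> C_pullback B"
    unfolding C2_def mem_Collect_eq prod.case by (elim conjE relcompE) (auto)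
  then show ?R
    unfolding mem_C_R_iff by (elim exE conjE) (auto simp: mem_C_pullback_iff)
next
  assume ?R
  then obtain \<kappa> \<beta> \<nu> where h: "(y, \<eta>) \<in> V" "\<kappa> \<noteq> 0" "\<bar>\<beta> - chi B \<nu>0 $ 2\<bar> < pi / 2"
     "\<eta> = \<kappa> *\<^sub>R wdir \<beta>" "\<nu> \<in> dom_in B" "chi B \<nu> = line_through y \<beta>"
     "q = (\<nu>, vector [\<kappa>, \<kappa> * (vdir \<beta> \<bullet> y)] v* d\<chi> B \<nu>)"
    by blast
  let ?p = "(line_through y \<beta>, vector [\<kappa>, \<kappa> * (vdir \<beta> \<bullet> y)])"
  have "((y, \<eta>), ?p) \<in> C_R (chi B \<nu>0 $ 2)" "(?p, q) \<in> C_pullback B"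
    using h(2-7) unfolding mem_C_R_iff mem_C_pullback_iff by blast+
  with h(1) show ?L
    unfolding C2_def by blast
qed

text \<open>A common value already yields the ray. Conversely, \<open>same_value\<close> also
  demands single-valuedness: the angle windows fix both orientations and multipliers, and
  injectivity of \<open>chi B\<close> fixes the ray.\<close>

lemma same_value_iff:
  assumes B: "broken_ray_family B" and "(x, \<xi>) \<in> V1" "(y, \<eta>) \<in> V2"
  shows "same_value (C1 \<nu>0 V1) (x, \<xi>) (C2 B \<nu>0 V2) (y, \<eta>) \<longleftrightarrow>
    (\<exists>\<nu>\<in>dom_in B. x \<in> line \<nu> \<and> y \<in> line (chi B \<nu>) \<and>
       \<bar>\<nu>$2 - \<nu>0$2\<bar> < pi / 2 \<and> \<bar>chi B \<nu> $ 2 - chi B \<nu>0 $ 2\<bar> < pi / 2 \<and>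
       (\<exists>\<mu> \<kappa>. \<mu> \<noteq> 0 \<and> \<kappa> \<noteq> 0 \<and> \<xi> = \<mu> *\<^sub>R wdir (\<nu>$2) \<and> \<eta> = \<kappa> *\<^sub>R wdir (chi B \<nu> $ 2) \<and>
          vector [\<mu>, \<mu> * (vdir (\<nu>$2) \<bullet> x)] =
          vector [\<kappa>, \<kappa> * (vdir (chi B \<nu> $ 2) \<bullet> y)] v* d\<chi> B \<nu>))" (is "?L \<longleftrightarrow> ?R")
proof
  assume ?L
  then obtain q where "((x, \<xi>), q) \<in> C1 \<nu>0 V1" "((y, \<eta>), q) \<in> C2 B \<nu>0 V2"
    unfolding same_value_def by auto
  then obtain \<mu> \<alpha> \<kappa> \<beta> \<nu> where h: "\<mu> \<noteq> 0" "\<bar>\<alpha> - \<nu>0$2\<bar> < pi / 2" "\<xi> = \<mu> *\<^sub>R wdir \<alpha>"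
      "q = (line_through x \<alpha>, vector [\<mu>, \<mu> * (vdir \<alpha> \<bullet> x)])"
      "\<kappa> \<noteq> 0" "\<bar>\<beta> - chi B \<nu>0 $ 2\<bar> < pi / 2" "\<eta> = \<kappa> *\<^sub>R wdir \<beta>" "\<nu> \<in> dom_in B"
      "chi B \<nu> = line_through y \<beta>" "q = (\<nu>, vector [\<kappa>, \<kappa> * (vdir \<beta> \<bullet> y)] v* d\<chi> B \<nu>)"
    unfolding mem_C1_iff mem_C2_iff by blast
  \<comment> \<open>Equal values have equal base points, so the incoming line pulled back from
    \<open>y\<close> is the line through \<open>x\<close>.\<close>
  then have "\<nu> = line_through x \<alpha>" by simp
  with h show ?R
    by (intro bexI[of _ \<nu>]) (auto simp: line_through_mem)
next
  assume ?R
  then obtain \<nu> \<mu> \<kappa> where h: "\<nu> \<in> dom_in B" "x \<in> line \<nu>" "y \<in> line (chi B \<nu>)"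
      "\<bar>\<nu>$2 - \<nu>0$2\<bar> < pi / 2" "\<bar>chi B \<nu> $ 2 - chi B \<nu>0 $ 2\<bar> < pi / 2"
      "\<mu> \<noteq> 0" "\<kappa> \<noteq> 0" "\<xi> = \<mu> *\<^sub>R wdir (\<nu>$2)" "\<eta> = \<kappa> *\<^sub>R wdir (chi B \<nu> $ 2)"
      "vector [\<mu>, \<mu> * (vdir (\<nu>$2) \<bullet> x)] =
          vector [\<kappa>, \<kappa> * (vdir (chi B \<nu> $ 2) \<bullet> y)] v* d\<chi> B \<nu>"
    by blast
  define q where "q = (\<nu>, vector [\<mu>, \<mu> * (vdir (\<nu>$2) \<bullet> x)] :: real^2)"
  have inj: "inj_on (chi B) (dom_in B)"
    using family_facts(4)[OF B] by (simp add: bij_betw_def)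
  have "C1 \<nu>0 V1 `` {(x, \<xi>)} = {q}"
  proof -
    have "q \<in> C1 \<nu>0 V1 `` {(x, \<xi>)}"
      unfolding q_def Image_singleton_iff mem_C1_iff
      using h(2,4,6,8) assms(2) line_through_eq[OF h(2)] by metis
    moreover have "q' = q" if q': "((x, \<xi>), q') \<in> C1 \<nu>0 V1" for q'
    proof -
      obtain \<mu>' \<alpha>' where h': "\<mu>' \<noteq> 0" "\<bar>\<alpha>' - \<nu>0$2\<bar> < pi / 2" "\<xi> = \<mu>' *\<^sub>R wdir \<alpha>'"
        "q' = (line_through x \<alpha>', vector [\<mu>', \<mu>' * (vdir \<alpha>' \<bullet> x)])"
        using q' unfolding mem_C1_iff by blast
      have "\<alpha>' = \<nu>$2" "\<mu>' = \<mu>"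
        using wdir_angle_unique[of \<mu>' \<alpha>' \<mu> "\<nu>$2" "\<nu>0$2"] h h' by auto
      then show ?thesis
        using h'(4) line_through_eq[OF h(2)] by (simp add: q_def)
    qed
    ultimately show ?thesis by blast
  qed
  moreover have "C2 B \<nu>0 V2 `` {(y, \<eta>)} = {q}"
  proof -
    have "q \<in> C2 B \<nu>0 V2 `` {(y, \<eta>)}"
      unfolding q_def Image_singleton_iff mem_C2_iff
      using h(1,5,7,9,10) assms(3) line_through_eq[OF h(3)]
      by (intro conjI exI[of _ \<kappa>] exI[of _ "chi B \<nu> $ 2"] exI[of _ \<nu>]) simp_all
    moreover have "q' = q" if q': "((y, \<eta>), q') \<in> C2 B \<nu>0 V2" for q'
    proof -
      obtain \<kappa>' \<beta>' \<nu>' where h': "\<kappa>' \<noteq> 0" "\<bar>\<beta>' - chi B \<nu>0 $ 2\<bar> < pi / 2" "\<eta> = \<kappa>' *\<^sub>R wdir \<beta>'"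
        "\<nu>' \<in> dom_in B" "chi B \<nu>' = line_through y \<beta>'"
        "q' = (\<nu>', vector [\<kappa>', \<kappa>' * (vdir \<beta>' \<bullet> y)] v* d\<chi> B \<nu>')"
        using q' unfolding mem_C2_iff by blast
      have eq: "\<beta>' = chi B \<nu> $ 2" "\<kappa>' = \<kappa>"
        using wdir_angle_unique[of \<kappa>' \<beta>' \<kappa> "chi B \<nu> $ 2" "chi B \<nu>0 $ 2"] h h' by auto
      then have "chi B \<nu>' = chi B \<nu>"
        using h'(5) line_through_eq[OF h(3)] by simp
      then have "\<nu>' = \<nu>"
        using inj h(1) h'(4) by (auto dest: inj_onD)
      then show ?thesis
        using h'(6) eq h(10) by (simp add: q_def)
    qed
    ultimately show ?thesis by blast
  qed
  ultimately show ?L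
    unfolding same_value_def by blast
qed


section \<open>Choice of neighborhoods and the equivalence for rays in \<Gamma>\<close>

theorem theorem1:
  fixes B :: rays and \<nu>0 x1 x2 \<xi>1 \<xi>2 :: "real^2"
  assumes "broken_ray_family B" and "\<nu>0 \<in> dom_in B"
    and "x1 \<in> incoming B \<nu>0" and "x2 \<in> outgoing B \<nu>0"
    and "\<xi>1 \<noteq> 0" and "\<xi>1 \<bullet> vdir (\<nu>0$2) = 0"
    and "\<xi>2 \<noteq> 0" and "\<xi>2 \<bullet> vdir (chi B \<nu>0 $ 2) = 0"
  shows "\<exists>\<Gamma>0. open \<Gamma>0 \<and> \<nu>0 \<in> \<Gamma>0 \<and>
    (\<forall>\<Gamma> U1 U2.
       open \<Gamma> \<and> \<nu>0 \<in> \<Gamma> \<and> \<Gamma> \<subseteq> \<Gamma>0 \<inter> dom_in B \<and>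
       open U1 \<and> x1 \<in> U1 \<and> open U2 \<and> x2 \<in> U2 \<and> U1 \<inter> U2 = {} \<and>
       (\<forall>\<nu>\<in>\<Gamma>. U1 \<inter> outgoing B \<nu> = {} \<and> U2 \<inter> incoming B \<nu> = {}) \<longrightarrow>
       (\<exists>W1 W2. conic_nbhd x1 \<xi>1 W1 \<and> conic_nbhd x2 \<xi>2 W2 \<and>
         (\<forall>V1 V2.
            conic_nbhd x1 \<xi>1 V1 \<and> V1 \<subseteq> W1 \<and> fst ` V1 \<subseteq> U1 \<and>
            conic_nbhd x2 \<xi>2 V2 \<and> V2 \<subseteq> W2 \<and> fst ` V2 \<subseteq> U2 \<longrightarrow>
            (\<forall>x \<xi> y \<eta>. (x, \<xi>) \<in> V1 \<and> (y, \<eta>) \<in> V2 \<longrightarrow>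
              (same_value (C1 \<nu>0 V1) (x, \<xi>) (C2 B \<nu>0 V2) (y, \<eta>) \<longleftrightarrow>
               (\<exists>\<nu>\<in>\<Gamma>. x \<in> incoming B \<nu> \<and> y \<in> outgoing B \<nu> \<and>
                  conjugate_along B \<nu> x y \<and>
                  (\<exists>\<mu>. \<mu> \<noteq> 0 \<and>
                     \<xi> = \<mu> *\<^sub>R wdir (\<nu>$2) \<and>
                     \<eta> = (\<mu> / det (d\<chi> B \<nu>) * d\<alpha>2_d\<alpha>1 B x (\<nu>$2)) *\<^sub>R wdir (chi B \<nu> $ 2))))))))"
proof -
  note B = assms(1)
  note facts = family_facts[OF B]
  \<comment> \<open>Outgoing data are indexed by the incoming line, whereas a covector at
    \<open>y\<close> selects the outgoing one; \<open>\<psi>\<close> converts the index so that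
    \<open>conic_nbhd_lines\<close> applies on \<open>dom_out B\<close>.\<close>
  define \<psi> where "\<psi> = inv_into (dom_in B) (chi B)"
  have \<psi>: "\<psi> (chi B \<nu>) = \<nu>" if "\<nu> \<in> dom_in B" for \<nu>
    using facts(4) that by (simp add: \<psi>_def bij_betw_def inv_into_f_f)
  have x1: "x1 \<in> line \<nu>0" "0 < - 1 * ((x1 - in_end B \<nu>0) \<bullet> vdir (\<nu>0$2))"
      "ereal (- 1 * ((x1 - in_end B \<nu>0) \<bullet> vdir (\<nu>0$2))) < in_len B \<nu>0"
    using assms(3) unfolding incoming_iff[OF B assms(2)] by auto
  have x2: "x2 \<in> line (chi B \<nu>0)"
      "0 < 1 * ((x2 - (out_start B \<circ> \<psi>) (chi B \<nu>0)) \<bullet> vdir (chi B \<nu>0 $ 2))"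
      "ereal (1 * ((x2 - (out_start B \<circ> \<psi>) (chi B \<nu>0)) \<bullet> vdir (chi B \<nu>0 $ 2)))
        < (out_len B \<circ> \<psi>) (chi B \<nu>0)"
    using assms(4) unfolding outgoing_iff[OF B assms(2)] by (auto simp: \<psi>[OF assms(2)])
  have chi0: "chi B \<nu>0 \<in> dom_out B"
    using facts(4) assms(2) by (auto simp: bij_betw_def)
  have \<psi>_im: "\<psi> ` dom_out B \<subseteq> dom_in B"
    using facts(4) by (auto simp: \<psi>_def bij_betw_def inv_into_into)
  have cont_\<psi>: "continuous_on (dom_out B) \<psi>"
    unfolding \<psi>_def by (rule smooth_on_continuous[OF facts(6)])
  have cont2: "continuous_on (dom_out B) (out_start B \<circ> \<psi>)" "continuous_on (dom_out B) (out_len B \<circ> \<psi>)"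
    by (intro continuous_on_compose[OF cont_\<psi>] continuous_on_subset[OF _ \<psi>_im]
        smooth_on_continuous[OF facts(8)] facts(11))+
  obtain W2 where W2: "conic_nbhd x2 \<xi>2 W2"
    and W2': "\<And>y \<kappa> \<beta>. (y, \<kappa> *\<^sub>R wdir \<beta>) \<in> W2 \<Longrightarrow> \<kappa> \<noteq> 0 \<Longrightarrow> \<bar>\<beta> - chi B \<nu>0 $ 2\<bar> < pi / 2 \<Longrightarrow>
      line_through y \<beta> \<in> dom_out B \<and>
      0 < 1 * ((y - (out_start B \<circ> \<psi>) (line_through y \<beta>)) \<bullet> vdir \<beta>) \<and>
      ereal (1 * ((y - (out_start B \<circ> \<psi>) (line_through y \<beta>)) \<bullet> vdir \<beta>))
        < (out_len B \<circ> \<psi>) (line_through y \<beta>)"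
    using conic_nbhd_lines[OF facts(3) chi0 cont2 assms(7,8) x2] by blast
  \<comment> \<open>Both angles of a ray in \<open>\<Gamma>0\<close> lie in the windows used by
    \<open>C_R\<close>, so a ray given by the right-hand side has the orientations selected by the
    canonical relations.\<close>
  define \<Gamma>0 where "\<Gamma>0 = dom_in B \<inter>
    (\<lambda>\<nu>. (\<bar>\<nu>$2 - \<nu>0$2\<bar>, \<bar>chi B \<nu> $ 2 - chi B \<nu>0 $ 2\<bar>)) -` ({..<pi/2} \<times> {..<pi/2})"
  have "open \<Gamma>0"
    unfolding \<Gamma>0_def
    by (intro continuous_open_preimage facts(2) open_Times open_lessThan continuous_intros
        smooth_on_continuous[OF facts(5)])
  moreover have "\<nu>0 \<in> \<Gamma>0"
    using assms(2) by (simp add: \<Gamma>0_def)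
  moreover have \<Gamma>0D: "\<bar>\<nu>$2 - \<nu>0$2\<bar> < pi / 2" "\<bar>chi B \<nu> $ 2 - chi B \<nu>0 $ 2\<bar> < pi / 2"
    if "\<nu> \<in> \<Gamma>0" for \<nu>
    using that by (auto simp: \<Gamma>0_def)
  moreover have "\<exists>W1 W2. conic_nbhd x1 \<xi>1 W1 \<and> conic_nbhd x2 \<xi>2 W2 \<and>
      (\<forall>V1 V2. conic_nbhd x1 \<xi>1 V1 \<and> V1 \<subseteq> W1 \<and> fst ` V1 \<subseteq> U1 \<and>
            conic_nbhd x2 \<xi>2 V2 \<and> V2 \<subseteq> W2 \<and> fst ` V2 \<subseteq> U2 \<longrightarrow>
            (\<forall>x \<xi> y \<eta>. (x, \<xi>) \<in> V1 \<and> (y, \<eta>) \<in> V2 \<longrightarrow>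
              (same_value (C1 \<nu>0 V1) (x, \<xi>) (C2 B \<nu>0 V2) (y, \<eta>) \<longleftrightarrow>
               (\<exists>\<nu>\<in>\<Gamma>. x \<in> incoming B \<nu> \<and> y \<in> outgoing B \<nu> \<and>
                  conjugate_along B \<nu> x y \<and>
                  (\<exists>\<mu>. \<mu> \<noteq> 0 \<and>
                     \<xi> = \<mu> *\<^sub>R wdir (\<nu>$2) \<and>
                     \<eta> = (\<mu> / det (d\<chi> B \<nu>) * d\<alpha>2_d\<alpha>1 B x (\<nu>$2)) *\<^sub>R wdir (chi B \<nu> $ 2))))))"
    if \<Gamma>: "open \<Gamma>" "\<nu>0 \<in> \<Gamma>" "\<Gamma> \<subseteq> \<Gamma>0 \<inter> dom_in B" for \<Gamma> U1 U2
  proof -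
    have cont1: "continuous_on \<Gamma> (in_end B)" "continuous_on \<Gamma> (in_len B)"
      using \<Gamma>(3) facts(10) smooth_on_continuous[OF facts(7)] by (auto elim: continuous_on_subset)
    \<comment> \<open>Taking \<Gamma> as the open set in \<open>conic_nbhd_lines\<close> forces the
      selected ray into \<Gamma>; hence \<open>W1\<close> is chosen after \<Gamma>, while
      \<open>W2\<close> is independent of it.\<close>
    obtain W1 where W1: "conic_nbhd x1 \<xi>1 W1"
      and W1': "\<And>x \<mu> \<alpha>. (x, \<mu> *\<^sub>R wdir \<alpha>) \<in> W1 \<Longrightarrow> \<mu> \<noteq> 0 \<Longrightarrow> \<bar>\<alpha> - \<nu>0$2\<bar> < pi / 2 \<Longrightarrow>
        line_through x \<alpha> \<in> \<Gamma> \<and> 0 < - 1 * ((x - in_end B (line_through x \<alpha>)) \<bullet> vdir \<alpha>) \<and>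
        ereal (- 1 * ((x - in_end B (line_through x \<alpha>)) \<bullet> vdir \<alpha>)) < in_len B (line_through x \<alpha>)"
      using conic_nbhd_lines[OF \<Gamma>(1,2) cont1 assms(5,6) x1] by blast
    have "same_value (C1 \<nu>0 V1) (x, \<xi>) (C2 B \<nu>0 V2) (y, \<eta>) \<longleftrightarrow>
               (\<exists>\<nu>\<in>\<Gamma>. x \<in> incoming B \<nu> \<and> y \<in> outgoing B \<nu> \<and>
                  conjugate_along B \<nu> x y \<and>
                  (\<exists>\<mu>. \<mu> \<noteq> 0 \<and>
                     \<xi> = \<mu> *\<^sub>R wdir (\<nu>$2) \<and>
                     \<eta> = (\<mu> / det (d\<chi> B \<nu>) * d\<alpha>2_d\<alpha>1 B x (\<nu>$2)) *\<^sub>R wdir (chi B \<nu> $ 2)))"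
      (is "_ \<longleftrightarrow> ?R")
      if V: "V1 \<subseteq> W1" "V2 \<subseteq> W2" "(x, \<xi>) \<in> V1" "(y, \<eta>) \<in> V2" for V1 V2 x \<xi> y \<eta>
      unfolding same_value_iff[OF B V(3,4)]
    proof
      assume "\<exists>\<nu>\<in>dom_in B. x \<in> line \<nu> \<and> y \<in> line (chi B \<nu>) \<and>
       \<bar>\<nu>$2 - \<nu>0$2\<bar> < pi / 2 \<and> \<bar>chi B \<nu> $ 2 - chi B \<nu>0 $ 2\<bar> < pi / 2 \<and>
       (\<exists>\<mu> \<kappa>. \<mu> \<noteq> 0 \<and> \<kappa> \<noteq> 0 \<and> \<xi> = \<mu> *\<^sub>R wdir (\<nu>$2) \<and> \<eta> = \<kappa> *\<^sub>R wdir (chi B \<nu> $ 2) \<and>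
          vector [\<mu>, \<mu> * (vdir (\<nu>$2) \<bullet> x)] =
          vector [\<kappa>, \<kappa> * (vdir (chi B \<nu> $ 2) \<bullet> y)] v* d\<chi> B \<nu>)"
      then obtain \<nu> \<mu> \<kappa> where h: "\<nu> \<in> dom_in B" "x \<in> line \<nu>" "y \<in> line (chi B \<nu>)"
        "\<bar>\<nu>$2 - \<nu>0$2\<bar> < pi / 2" "\<bar>chi B \<nu> $ 2 - chi B \<nu>0 $ 2\<bar> < pi / 2"
        "\<mu> \<noteq> 0" "\<kappa> \<noteq> 0" "\<xi> = \<mu> *\<^sub>R wdir (\<nu>$2)" "\<eta> = \<kappa> *\<^sub>R wdir (chi B \<nu> $ 2)"
        "vector [\<mu>, \<mu> * (vdir (\<nu>$2) \<bullet> x)] =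
          vector [\<kappa>, \<kappa> * (vdir (chi B \<nu> $ 2) \<bullet> y)] v* d\<chi> B \<nu>"
        by blast
      have "\<nu> \<in> \<Gamma>" "x \<in> incoming B \<nu>"
        using W1'[of x \<mu> "\<nu>$2"] V h
        by (auto simp: line_through_eq incoming_iff[OF B])
      \<comment> \<open>The line through \<open>y\<close> with the outgoing angle is
        \<open>chi B \<nu>\<close>, and \<open>\<psi>\<close> returns it to \<nu>, so the conditions
        from \<open>W2\<close> concern this very ray.\<close>
      moreover have "y \<in> outgoing B \<nu>"
        using W2'[of y \<kappa> "chi B \<nu> $ 2"] V h
        by (auto simp: line_through_eq outgoing_iff[OF B] \<psi>)
      moreover have "conjugate_along B \<nu> x y" "\<kappa> = \<mu> / det (d\<chi> B \<nu>) * d\<alpha>2_d\<alpha>1 B x (\<nu>$2)"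
        using covector_eq_iff[OF B h(1-3,6)] h(10) by blast+
      ultimately show ?R
        using h(6,8,9) by (intro bexI[of _ \<nu>] conjI exI[of _ \<mu>]) simp_all
    next
      assume ?R
      then obtain \<nu> \<mu> where h: "\<nu> \<in> \<Gamma>" "x \<in> incoming B \<nu>" "y \<in> outgoing B \<nu>"
        "conjugate_along B \<nu> x y" "\<mu> \<noteq> 0" "\<xi> = \<mu> *\<^sub>R wdir (\<nu>$2)"
        "\<eta> = (\<mu> / det (d\<chi> B \<nu>) * d\<alpha>2_d\<alpha>1 B x (\<nu>$2)) *\<^sub>R wdir (chi B \<nu> $ 2)"
        by blast
      define \<kappa> where "\<kappa> = \<mu> / det (d\<chi> B \<nu>) * d\<alpha>2_d\<alpha>1 B x (\<nu>$2)"
      \<comment> \<open>The derivative of \<open>\<alpha>2\<close> could vanish; it does not because \<open>\<eta>\<close> lies in a conic neighborhood.\<close>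
      have "\<eta> \<noteq> 0"
        using W2 V unfolding conic_nbhd_def by blast
      then have \<kappa>: "\<kappa> \<noteq> 0" "\<eta> = \<kappa> *\<^sub>R wdir (chi B \<nu> $ 2)"
        using h(7) by (auto simp: \<kappa>_def)
      have \<nu>: "\<nu> \<in> dom_in B" "\<nu> \<in> \<Gamma>0" using h(1) \<Gamma>(3) by auto
      have xy: "x \<in> line \<nu>" "y \<in> line (chi B \<nu>)"
        using h(2,3) by (simp_all add: incoming_iff[OF B \<nu>(1)] outgoing_iff[OF B \<nu>(1)])
      have "vector [\<mu>, \<mu> * (vdir (\<nu>$2) \<bullet> x)] =
          vector [\<kappa>, \<kappa> * (vdir (chi B \<nu> $ 2) \<bullet> y)] v* d\<chi> B \<nu>"
        using covector_eq_iff[OF B \<nu>(1) xy h(5)] h(4) \<kappa>_def by blast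
      then show "\<exists>\<nu>\<in>dom_in B. x \<in> line \<nu> \<and> y \<in> line (chi B \<nu>) \<and>
       \<bar>\<nu>$2 - \<nu>0$2\<bar> < pi / 2 \<and> \<bar>chi B \<nu> $ 2 - chi B \<nu>0 $ 2\<bar> < pi / 2 \<and>
       (\<exists>\<mu> \<kappa>. \<mu> \<noteq> 0 \<and> \<kappa> \<noteq> 0 \<and> \<xi> = \<mu> *\<^sub>R wdir (\<nu>$2) \<and> \<eta> = \<kappa> *\<^sub>R wdir (chi B \<nu> $ 2) \<and>
          vector [\<mu>, \<mu> * (vdir (\<nu>$2) \<bullet> x)] =
          vector [\<kappa>, \<kappa> * (vdir (chi B \<nu> $ 2) \<bullet> y)] v* d\<chi> B \<nu>)"
        using \<nu> xy \<Gamma>0D[OF \<nu>(2)] h(5,6) \<kappa> by blast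
    qed
    then have "\<forall>V1 V2. conic_nbhd x1 \<xi>1 V1 \<and> V1 \<subseteq> W1 \<and> fst ` V1 \<subseteq> U1 \<and>
            conic_nbhd x2 \<xi>2 V2 \<and> V2 \<subseteq> W2 \<and> fst ` V2 \<subseteq> U2 \<longrightarrow>
            (\<forall>x \<xi> y \<eta>. (x, \<xi>) \<in> V1 \<and> (y, \<eta>) \<in> V2 \<longrightarrow>
              (same_value (C1 \<nu>0 V1) (x, \<xi>) (C2 B \<nu>0 V2) (y, \<eta>) \<longleftrightarrow>
               (\<exists>\<nu>\<in>\<Gamma>. x \<in> incoming B \<nu> \<and> y \<in> outgoing B \<nu> \<and>
                  conjugate_along B \<nu> x y \<and>
                  (\<exists>\<mu>. \<mu> \<noteq> 0 \<and>
                     \<xi> = \<mu> *\<^sub>R wdir (\<nu>$2) \<and>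
                     \<eta> = (\<mu> / det (d\<chi> B \<nu>) * d\<alpha>2_d\<alpha>1 B x (\<nu>$2)) *\<^sub>R wdir (chi B \<nu> $ 2)))))"
      by simp
    with W1 W2 show ?thesis by blast
  qed
  ultimately show ?thesis
    by (intro exI[of _ \<Gamma>0]) simp
qed

end
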